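(* Consider the PHEV-charging dynamic program described in the context. Suppose the penalty function satisfies $0\le q(n)-q(n-1)\le q(n+1)-q(n)$ for all $n=1,2,\ldots$. Suppose that at some stage $t$ and system state $\mathbf{x}_t$ vehicle $j$ has priority over vehicle $i$ (that is, $i\preccurlyeq j$), and that a feasible policy $\pi=\{\nu_0,\nu_1,\ldots\}$ charges vehicle $i$ but not vehicle $j$ at $\mathbf{x}_t$. Let $\bar\pi$ be the interchanging policy generated from $\pi$ with respect to vehicles $i$ and $j$ at state $\mathbf{x}_t$. Then for every $T\ge \max\{\lambda_{j,t},\lambda_{i,t}\}-1$ and along every sample path from stage $t+1$ through stage $t+T$ following $\mathbf{x}_t$, the total realized cost resulting from $\bar\pi$ is not higher than the total realized cost resulting from $\pi$. Explicitly, if $\{\mathbf{x}_k\}_{k=t+1}^{t+T}$ is the realized state sequence under $\pi$ and $\{\bar{\mathbf{x}}_k\}_{k=t+1}^{t+T}$ is the corresponding realized state sequence under $\bar\pi$, both starting from $\bar{\mathbf{x}}_t=\mathbf{x}_t$, and $\mathbf{a}_k$, $\bar{\mathbf{a}}_k$ are the actions taken by $\pi$ and $\bar\pi$ at stage $k$ along these sequences, then $$\sum_{k=t}^{t+T} g(\bar{\mathbf{x}}_k,\bar{\mathbf{a}}_k)\ \le\ \sum_{k=t}^{t+T} g(\mathbf{x}_k,\mathbf{a}_k).$$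
   Context: **Model.** Time is discrete, $t=0,1,2,\ldots$. There are $N$ chargers; the vehicle connected to charger $i$ is called vehicle $i$. $\mathcal{I}_t\subseteq\{1,\ldots,N\}$ is the set of chargers connected to a vehicle at stage $t$. Vehicle $i$ has arrival time $\alpha_i$ and departure time (deadline) $\beta_i$ with $1\le\beta_i-\alpha_i\le B$; it can be charged at stages $\alpha_i,\ldots,\beta_i-1$, stays connected to its charger during these stages, and leaves at the beginning of stage $\beta_i$. For $i\in\mathcal{I}_t$ the state of vehicle $i$ is $x_{i,t}=(\lambda_{i,t},\gamma_{i,t})$, where $\lambda_{i,t}=\beta_i-t\ge 1$ is the number of remaining stages and $\gamma_{i,t}\in\{0,1,\ldots,E\}$ is the remaining processing time (number of units of charging still needed). For $i\notin\mathcal{I}_t$, $x_{i,t}=(0,0)$. An action is $\mathbf{a}_t=(a_{1,t},\ldots,a_{N,t})\in\{0,1\}^N$ ($a_{i,t}=1$ means vehicle $i$ is charged); it is feasible if $a_{i,t}\le\gamma_{i,t}$ for all $i$. Let $A_t=\sum_{i\in\mathcal{I}_t}a_{i,t}$. If vehicle $i$ remains connected at stage $t+1$, then $x_{i,t+1}=x_{i,t}-(1,a_{i,t})$. If a vehicle arrives at an empty charger $i$ at stage $t+1$, the state of charger $i$ becomes the initial state of this vehicle. The grid state $s_t$ lies in a finite set $\mathcal{S}$ and evolves randomly with a law depending only on $s_t$ and the aggregate action $A_t$. The demand state $d_t$ lies in a finite set $\mathcal{D}$, evolves as a time-homogeneous Markov chain whose transitions are independent of $s_t$ and $\mathbf{a}_t$,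 and determines the joint distribution of the numbers of future arriving vehicles and their initial states. Arrivals and their assignment to chargers are not affected by the charging actions. The system state $\mathbf{x}_t$ consists of $\{x_{i,t}\}_{i=1}^N$, $s_t$ and $d_t$; the set $\mathcal{X}$ of system states is finite. The stage cost is $$g(\mathbf{x}_t,\mathbf{a}_t)=C(A_t,s_t)+\sum_{j\in\mathcal{J}(\mathbf{x}_t)}q(\gamma_{j,t}-a_{j,t}),\qquad \mathcal{J}(\mathbf{x}_t)=\{j\in\mathcal{I}_t:\lambda_{j,t}=1\},$$ where $C$ is a real-valued charging cost function and $q:\mathbb{Z}_+\to[0,\infty)$ with $q(0)=0$ is the non-completion penalty. A feasible policy $\pi=\{\nu_0,\nu_1,\ldots\}$ is a sequence of decision rules such that $\nu_t(\mathbf{x}_t)$ is a feasible action for every $t$ and $\mathbf{x}_t$. **Laxity and priority.** For $i\in\mathcal{I}_t$ the laxity is $\theta_{i,t}=\lambda_{i,t}-\gamma_{i,t}$ if $\gamma_{i,t}>0$, and $\theta_{i,t}=B$ if $\gamma_{i,t}=0$. For $i,j\in\mathcal{I}_t$, $i\preccurlyeq j$ (vehicle $j$ has priority over $i$) means $\theta_{i,t}\ge\theta_{j,t}$ and $\gamma_{i,t}\le\gamma_{j,t}$, with at least one of the two inequalities strict. **Interchanging policy.** Suppose at stage $t$ and state $\mathbf{x}_t$ vehicle $j$ has priority over $i$ and $\pi$ charges $i$ but not $j$. Let $W=\max\{\lambda_{i,t},\lambda_{j,t}\}-1$. The interchanging policy $\bar\pi=\{\nu_0,\ldots,\nu_{t-1},\bar\nu_t,\bar\nu_{t+1},\ldots\}$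 agrees with $\pi$ except as follows (for $k>t$ the modified actions are prescribed along trajectories following $\mathbf{x}_t$). (1) At $\mathbf{x}_t$, $\bar\nu_t(\mathbf{x}_t)$ equals $\nu_t(\mathbf{x}_t)$ except that its $i$th component is $0$ and its $j$th component is $1$. (2) To each state sequence $\{\mathbf{x}_k\}_{k=t+1}^{t+W}$ that follows $\mathbf{x}_t$ with positive probability under $\pi$, associate the sequence $\{\hat{\mathbf{x}}_k\}_{k=t+1}^{t+W}$, where $\hat{\mathbf{x}}_k$ differs from $\mathbf{x}_k$ only in that $\hat\gamma_{i,k}=\gamma_{i,k}+1$ for $k=t+1,\ldots,\beta_i-1$ and $\hat\gamma_{j,k}=\gamma_{j,k}-1$ for $k=t+1,\ldots,\beta_j-1$. (3) Let $\mathcal{G}\subseteq\{t+1,\ldots,\min\{\beta_i,\beta_j\}-1\}$ be the set of stages at which $\pi$, along $\{\mathbf{x}_k\}$, charges vehicle $j$ but not $i$. If $\mathcal{G}=\emptyset$, then $\bar\nu_k(\hat{\mathbf{x}}_k)=\nu_k(\mathbf{x}_k)$ for $k=t+1,\ldots,t+W$. If $\mathcal{G}\ne\emptyset$, let $w=\min\mathcal{G}$; then $\bar\nu_k(\hat{\mathbf{x}}_k)=\nu_k(\mathbf{x}_k)$ for $k=t+1,\ldots,w-1$, and $\bar\nu_w(\hat{\mathbf{x}}_w)$ equals $\nu_w(\mathbf{x}_w)$ except that its $i$th component is $1$ and its $j$th component is $0$; after stage $w$, $\bar\pi$ agrees with $\pi$. **Sample paths.** The interchanging policy charges the same number of vehicles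 as $\pi$ at every stage along corresponding trajectories. A sample path is a realization of the grid states, demand states and vehicle arrivals that has positive probability under $\pi$ following $\mathbf{x}_t$; the corresponding realized state sequence under $\bar\pi$ is the one obtained from $\mathbf{x}_t$ with the same realization of grid states, demand states and arrivals and with the actions of $\bar\pi$. *)

theory Defs
  imports "HOL-Probability.Probability_Mass_Function"
begin

text \<open>
  Chargers are the elements of a finite type \<open>'n\<close>, grid states and demand states the elements of
  finite types \<open>'s\<close> and \<open>'d\<close>. A vehicle state is a pair \<open>(\<lambda>, \<gamma>)\<close> of remaining stages and remaining
  processing time; an unoccupied charger has state \<open>(0, 0)\<close>.
\<close>

type_synonym vehicle_state = "nat \<times> nat"

record ('n, 's, 'd) sys_state =
  vehicle :: "'n \<Rightarrow> vehicle_state"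
  grid :: 's
  demand :: 'd

type_synonym 'n action = "'n \<Rightarrow> nat"

text \<open>\<open>arrivals i = Some v\<close>: a vehicle with initial state \<open>v\<close> arrives at charger \<open>i\<close>.\<close>

type_synonym 'n arrivals = "'n \<Rightarrow> vehicle_state option"

text \<open>The uncontrolled information revealed at a stage: new grid state, new demand state, arrivals.\<close>

type_synonym ('n, 's, 'd) outcome = "'s \<times> 'd \<times> 'n arrivals"

text \<open>
  \<open>arrival_law M d d' l\<close> is the law of the arrivals (with their assignment to chargers) at stage
  \<open>t + 1\<close>, where \<open>d\<close> and \<open>d'\<close> are the demand states at \<open>t\<close> and \<open>t + 1\<close> and \<open>l\<close> is the vector of
  remaining stages at \<open>t\<close>. Since \<open>l\<close> is not affected by actions, neither are the arrivals; \<open>l\<close>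
  records which chargers are free.
\<close>

record ('n, 's, 'd) phev =
  max_stay :: nat
  max_proc :: nat
  grid_law :: "'s \<Rightarrow> nat \<Rightarrow> 's pmf"
  demand_law :: "'d \<Rightarrow> 'd pmf"
  arrival_law :: "'d \<Rightarrow> 'd \<Rightarrow> ('n \<Rightarrow> nat) \<Rightarrow> 'n arrivals pmf"
  charging_cost :: "nat \<Rightarrow> 's \<Rightarrow> real"
  penalty :: "nat \<Rightarrow> real"

definition initial_vehicle_states :: "('n, 's, 'd) phev \<Rightarrow> vehicle_state set" where
  "initial_vehicle_states M = {1..max_stay M} \<times> {0..max_proc M}"

text \<open>
  A vehicle with \<open>l i = 1\<close> leaves at the beginning of the next stage, so charger \<open>i\<close> is empty at the
  next stage iff \<open>l i \<le> 1\<close>.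
\<close>

definition phev_model :: "('n::finite, 's::finite, 'd::finite) phev \<Rightarrow> bool" where
  "phev_model M \<longleftrightarrow>
     (\<forall>d d' l. \<forall>e \<in> set_pmf (arrival_law M d d' l). \<forall>i v.
        e i = Some v \<longrightarrow> l i \<le> 1 \<and> v \<in> initial_vehicle_states M) \<and>
     (\<forall>n. 0 \<le> penalty M n) \<and> penalty M 0 = 0"

definition sys_states :: "('n, 's, 'd) phev \<Rightarrow> ('n, 's, 'd) sys_state set" where
  "sys_states M = {x. \<forall>i. vehicle x i \<in> insert (0, 0) (initial_vehicle_states M)}"

definition rem_stages :: "('n, 's, 'd) sys_state \<Rightarrow> 'n \<Rightarrow> nat" where
  "rem_stages x i = fst (vehicle x i)"

definition rem_proc :: "('n, 's, 'd) sys_state \<Rightarrow> 'n \<Rightarrow> nat" where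
  "rem_proc x i = snd (vehicle x i)"

definition connected_chargers :: "('n, 's, 'd) sys_state \<Rightarrow> 'n set" where
  "connected_chargers x = {i. 1 \<le> rem_stages x i}"

definition feasible_action :: "('n, 's, 'd) sys_state \<Rightarrow> 'n action \<Rightarrow> bool" where
  "feasible_action x a \<longleftrightarrow> (\<forall>i. a i \<in> {0, 1} \<and> a i \<le> rem_proc x i)"

definition num_charged :: "('n, 's, 'd) sys_state \<Rightarrow> 'n action \<Rightarrow> nat" where
  "num_charged x a = (\<Sum>i \<in> connected_chargers x. a i)"

definition stage_cost ::
  "('n, 's, 'd) phev \<Rightarrow> ('n, 's, 'd) sys_state \<Rightarrow> 'n action \<Rightarrow> real" where
  "stage_cost M x a =
     charging_cost M (num_charged x a) (grid x) +
     (\<Sum>j \<in> {j \<in> connected_chargers x. rem_stages x j = 1}. penalty M (rem_proc x j - a j))"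

definition next_state ::
  "('n, 's, 'd) sys_state \<Rightarrow> 'n action \<Rightarrow> ('n, 's, 'd) outcome \<Rightarrow> ('n, 's, 'd) sys_state" where
  "next_state x a z = (case z of (s', d', e) \<Rightarrow>
     \<lparr> vehicle = (\<lambda>i. if rem_stages x i > 1 then (rem_stages x i - 1, rem_proc x i - a i)
                     else (case e i of None \<Rightarrow> (0, 0) | Some v \<Rightarrow> v)),
       grid = s', demand = d' \<rparr>)"

definition outcome_law ::
  "('n, 's, 'd) phev \<Rightarrow> ('n, 's, 'd) sys_state \<Rightarrow> 'n action \<Rightarrow> ('n, 's, 'd) outcome pmf" where
  "outcome_law M x a =
     bind_pmf (grid_law M (grid x) (num_charged x a)) (\<lambda>s'.
     bind_pmf (demand_law M (demand x)) (\<lambda>d'.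
     map_pmf (\<lambda>e. (s', d', e)) (arrival_law M (demand x) d' (rem_stages x))))"

text \<open>
  A policy \<open>\<nu>\<close> is Markov: \<open>\<nu> k x\<close> is the action at stage \<open>k\<close> and state \<open>x\<close>. The actions of the
  interchanging policy are prescribed along trajectories, and one state may be reached
  along trajectories with different prescriptions; it is therefore a history-dependent policy
  \<open>\<rho>\<close>, where \<open>\<rho> k h\<close> is the action at stage \<open>k\<close> if the state sequence is \<open>h\<close>
  (only stages up to \<open>k\<close> matter).
\<close>

type_synonym ('n, 's, 'd) policy = "nat \<Rightarrow> ('n, 's, 'd) sys_state \<Rightarrow> 'n action"

type_synonym ('n, 's, 'd) history_policy =
  "nat \<Rightarrow> (nat \<Rightarrow> ('n, 's, 'd) sys_state) \<Rightarrow> 'n action"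

definition history_policy_of :: "('n, 's, 'd) policy \<Rightarrow> ('n, 's, 'd) history_policy" where
  "history_policy_of \<nu> = (\<lambda>k h. \<nu> k (h k))"

definition feasible_policy :: "('n, 's, 'd) phev \<Rightarrow> ('n, 's, 'd) policy \<Rightarrow> bool" where
  "feasible_policy M \<nu> \<longleftrightarrow> (\<forall>k. \<forall>x \<in> sys_states M. feasible_action x (\<nu> k x))"

text \<open>
  \<open>x t, \<dots>, x (t + n)\<close> are the states realized from \<open>xt\<close> at stage \<open>t\<close> under \<open>\<rho>\<close> when \<open>\<omega> k\<close> is
  the outcome revealed at stage \<open>k\<close>.
\<close>

definition realized_states ::
  "('n, 's, 'd) history_policy \<Rightarrow> nat \<Rightarrow> ('n, 's, 'd) sys_state \<Rightarrow> nat \<Rightarrow>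
   (nat \<Rightarrow> ('n, 's, 'd) outcome) \<Rightarrow> (nat \<Rightarrow> ('n, 's, 'd) sys_state) \<Rightarrow> bool" where
  "realized_states \<rho> t xt n \<omega> x \<longleftrightarrow>
     x t = xt \<and> (\<forall>k \<in> {t..<t + n}. x (Suc k) = next_state (x k) (\<rho> k x) (\<omega> (Suc k)))"

text \<open>
  \<open>\<omega>\<close> is a sample path for stages \<open>t + 1, \<dots>, t + n\<close>, of positive probability under \<open>\<nu>\<close>, and \<open>x\<close>
  is the state sequence it generates.
\<close>

definition sample_path ::
  "('n, 's, 'd) phev \<Rightarrow> ('n, 's, 'd) policy \<Rightarrow> nat \<Rightarrow> ('n, 's, 'd) sys_state \<Rightarrow> nat \<Rightarrow>
   (nat \<Rightarrow> ('n, 's, 'd) outcome) \<Rightarrow> (nat \<Rightarrow> ('n, 's, 'd) sys_state) \<Rightarrow> bool" where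
  "sample_path M \<nu> t xt n \<omega> x \<longleftrightarrow>
     realized_states (history_policy_of \<nu>) t xt n \<omega> x \<and>
     0 < (\<Prod>k \<in> {t..<t + n}. pmf (outcome_law M (x k) (\<nu> k (x k))) (\<omega> (Suc k)))"

definition laxity :: "('n, 's, 'd) phev \<Rightarrow> ('n, 's, 'd) sys_state \<Rightarrow> 'n \<Rightarrow> int" where
  "laxity M x i =
     (if rem_proc x i > 0 then int (rem_stages x i) - int (rem_proc x i) else int (max_stay M))"

text \<open>\<open>prec M x i j\<close>: vehicle \<open>j\<close> has priority over vehicle \<open>i\<close>.\<close>

definition prec :: "('n, 's, 'd) phev \<Rightarrow> ('n, 's, 'd) sys_state \<Rightarrow> 'n \<Rightarrow> 'n \<Rightarrow> bool" where
  "prec M x i j \<longleftrightarrow>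
     i \<in> connected_chargers x \<and> j \<in> connected_chargers x \<and>
     laxity M x i \<ge> laxity M x j \<and> rem_proc x i \<le> rem_proc x j \<and>
     (laxity M x i > laxity M x j \<or> rem_proc x i < rem_proc x j)"

text \<open>The deadline of the vehicle connected to charger \<open>i\<close> in state \<open>xt\<close> at stage \<open>t\<close>.\<close>

definition deadline :: "nat \<Rightarrow> ('n, 's, 'd) sys_state \<Rightarrow> 'n \<Rightarrow> nat" where
  "deadline t xt i = t + rem_stages xt i"

definition interchange_span :: "('n, 's, 'd) sys_state \<Rightarrow> 'n \<Rightarrow> 'n \<Rightarrow> nat" where
  "interchange_span xt i j = max (rem_stages xt i) (rem_stages xt j) - 1"

text \<open>The state at stage \<open>k\<close> associated with the state \<open>x\<close> at stage \<open>k\<close>.\<close>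

definition hat ::
  "nat \<Rightarrow> ('n, 's, 'd) sys_state \<Rightarrow> 'n \<Rightarrow> 'n \<Rightarrow> nat \<Rightarrow> ('n, 's, 'd) sys_state \<Rightarrow>
   ('n, 's, 'd) sys_state" where
  "hat t xt i j k x = x \<lparr> vehicle := (\<lambda>l.
     if l = i \<and> k < deadline t xt i then (rem_stages x i, rem_proc x i + 1)
     else if l = j \<and> k < deadline t xt j then (rem_stages x j, rem_proc x j - 1)
     else vehicle x l) \<rparr>"

text \<open>The set of stages at which \<open>\<nu>\<close>, along the state sequence \<open>x\<close>, charges \<open>j\<close> but not \<open>i\<close>.\<close>

definition swap_stages ::
  "('n, 's, 'd) policy \<Rightarrow> nat \<Rightarrow> ('n, 's, 'd) sys_state \<Rightarrow> 'n \<Rightarrow> 'n \<Rightarrow>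
   (nat \<Rightarrow> ('n, 's, 'd) sys_state) \<Rightarrow> nat set" where
  "swap_stages \<nu> t xt i j x =
     {k \<in> {t + 1..<min (deadline t xt i) (deadline t xt j)}. \<nu> k (x k) j = 1 \<and> \<nu> k (x k) i = 0}"

text \<open>
  \<open>prescribed M \<nu> t xt i j k h a\<close>: the interchanging policy is required to take action \<open>a\<close> at stage
  \<open>k\<close> along the history \<open>h\<close> of its own states.
\<close>

inductive prescribed ::
  "('n, 's, 'd) phev \<Rightarrow> ('n, 's, 'd) policy \<Rightarrow> nat \<Rightarrow> ('n, 's, 'd) sys_state \<Rightarrow> 'n \<Rightarrow> 'n \<Rightarrow>
   nat \<Rightarrow> (nat \<Rightarrow> ('n, 's, 'd) sys_state) \<Rightarrow> 'n action \<Rightarrow> bool"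
  for M \<nu> t xt i j where
  exchange:
    "\<lbrakk> h t = xt \<rbrakk> \<Longrightarrow> prescribed M \<nu> t xt i j t h ((\<nu> t xt)(i := 0, j := 1))"
| mimic:
    "\<lbrakk> sample_path M \<nu> t xt (interchange_span xt i j) \<omega> x;
       t < k; k \<le> t + interchange_span xt i j;
       h t = xt; \<forall>m \<in> {t<..k}. h m = hat t xt i j m (x m);
       swap_stages \<nu> t xt i j x = {} \<or> k < Min (swap_stages \<nu> t xt i j x) \<rbrakk>
     \<Longrightarrow> prescribed M \<nu> t xt i j k h (\<nu> k (x k))"
| restore:
    "\<lbrakk> sample_path M \<nu> t xt (interchange_span xt i j) \<omega> x;
       swap_stages \<nu> t xt i j x \<noteq> {}; w = Min (swap_stages \<nu> t xt i j x);
       h t = xt; \<forall>m \<in> {t<..w}. h m = hat t xt i j m (x m) \<rbrakk>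
     \<Longrightarrow> prescribed M \<nu> t xt i j w h ((\<nu> w (x w))(i := 1, j := 0))"
| after_restore:
    "\<lbrakk> sample_path M \<nu> t xt (interchange_span xt i j) \<omega> x;
       swap_stages \<nu> t xt i j x \<noteq> {}; w = Min (swap_stages \<nu> t xt i j x);
       h t = xt; \<forall>m \<in> {t<..w}. h m = hat t xt i j m (x m); w < k \<rbrakk>
     \<Longrightarrow> prescribed M \<nu> t xt i j k h (\<nu> k (h k))"

definition interchanging_policy ::
  "('n, 's, 'd) phev \<Rightarrow> ('n, 's, 'd) policy \<Rightarrow> nat \<Rightarrow> ('n, 's, 'd) sys_state \<Rightarrow> 'n \<Rightarrow> 'n \<Rightarrow>
   ('n, 's, 'd) history_policy" where
  "interchanging_policy M \<nu> t xt i j = (\<lambda>k h.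
     if \<exists>a. prescribed M \<nu> t xt i j k h a then (THE a. prescribed M \<nu> t xt i j k h a)
     else \<nu> k (h k))"

end

(* Until the first swap stage, one more unit remains for i and one less for j under the
   interchanging policy; a swap stage cancels both differences, and then all stage costs agree. If there is no swap
   stage, only the penalties of i and j change: with residuals r_i and r_j under the original
   policy, the change is (q(r_i + 1) - q(r_i)) - (q(r_j) - q(r_j - 1)). By convexity of q it
   suffices that r_i < r_j. While both vehicles are present, a policy without swap stages charges j
   only together with i, so the gap in remaining processing time can only grow; after i has left,
   the laxity condition bounds how much of the gap j can make up. *)
theory Submission
  imports Defs
begin

section \<open>State dynamics and sample paths\<close>

text \<open>A feasible policy is constrained only on \<open>sys_states M\<close>; invariance of this
  set makes every action along a sample path feasible.\<close>

lemma next_state_in_sys_states: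
  assumes model: "phev_model M" and x: "x \<in> sys_states M"
    and z: "z \<in> set_pmf (outcome_law M x a)"
  shows "next_state x a z \<in> sys_states M"
proof -
  obtain s' d' e where z_eq: "z = (s', d', e)"
    by (cases z) auto
  with z have e: "e \<in> set_pmf (arrival_law M (demand x) d' (rem_stages x))"
    by (auto simp: outcome_law_def)
  have arr: "v \<in> initial_vehicle_states M" if "e l = Some v" for l v
    using model e that unfolding phev_model_def by blast
  have veh: "vehicle x l \<in> insert (0, 0) (initial_vehicle_states M)" for l
    using x by (auto simp: sys_states_def)
  show ?thesis
    unfolding sys_states_def mem_Collect_eq
  proof
    fix l
    show "vehicle (next_state x a z) l \<in> insert (0, 0) (initial_vehicle_states M)"
    proof (cases "rem_stages x l > 1")
      case True
      then have "vehicle x l \<in> initial_vehicle_states M"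
        using veh[of l] by (auto simp: rem_stages_def)
      with True show ?thesis
        by (cases "vehicle x l")
          (auto simp: next_state_def z_eq rem_stages_def rem_proc_def initial_vehicle_states_def)
    next
      case False
      then show ?thesis
        using arr by (auto simp: next_state_def z_eq split: option.splits)
    qed
  qed
qed

lemma rem_stages_next_state:
  "rem_stages x l > 1 \<Longrightarrow> rem_stages (next_state x a z) l = rem_stages x l - 1"
  by (auto simp: next_state_def rem_stages_def split: prod.splits)

lemma rem_proc_next_state:
  "rem_stages x l > 1 \<Longrightarrow> rem_proc (next_state x a z) l = rem_proc x l - a l"
  by (auto simp: next_state_def rem_stages_def rem_proc_def split: prod.splits)

text \<open>Only the work left after the action enters the next state, so at a swap stage different
  states with different actions can have the same successor.\<close>

lemma next_state_eqI:
  assumes "\<And>l. rem_stages x l = rem_stages y l"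
    and "\<And>l. rem_stages y l > 1 \<Longrightarrow> rem_proc x l - a l = rem_proc y l - b l"
  shows "next_state x a z = next_state y b z"
  using assms by (auto simp: next_state_def split: prod.splits)

lemma sample_path_step:
  assumes "sample_path M \<nu> t xt n \<omega> x" and "t \<le> k" and "k < t + n"
  shows "x (Suc k) = next_state (x k) (\<nu> k (x k)) (\<omega> (Suc k))"
    and "\<omega> (Suc k) \<in> set_pmf (outcome_law M (x k) (\<nu> k (x k)))"
proof -
  show "x (Suc k) = next_state (x k) (\<nu> k (x k)) (\<omega> (Suc k))"
    using assms by (auto simp: sample_path_def realized_states_def history_policy_of_def)
  have pos: "0 < (\<Prod>k \<in> {t..<t + n}. pmf (outcome_law M (x k) (\<nu> k (x k))) (\<omega> (Suc k)))"
    using assms(1) unfolding sample_path_def by blast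
  have "pmf (outcome_law M (x k) (\<nu> k (x k))) (\<omega> (Suc k)) \<noteq> 0"
  proof
    assume "pmf (outcome_law M (x k) (\<nu> k (x k))) (\<omega> (Suc k)) = 0"
    then have "(\<Prod>k \<in> {t..<t + n}. pmf (outcome_law M (x k) (\<nu> k (x k))) (\<omega> (Suc k))) = 0"
      using assms(2,3) by (intro prod_zero) auto
    with pos show False
      by simp
  qed
  then show "\<omega> (Suc k) \<in> set_pmf (outcome_law M (x k) (\<nu> k (x k)))"
    by (simp add: set_pmf_iff)
qed

lemma sample_path_start: "sample_path M \<nu> t xt n \<omega> x \<Longrightarrow> x t = xt"
  by (simp add: sample_path_def realized_states_def)

text \<open>Cuts a path of length \<open>T\<close> down to length
  \<open>interchange_span xt i j\<close>, the length that \<open>prescribed\<close> refers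
  to.\<close>

lemma sample_path_mono:
  assumes "sample_path M \<nu> t xt n \<omega> x" and "n' \<le> n"
  shows "sample_path M \<nu> t xt n' \<omega> x"
proof -
  have "pmf (outcome_law M (x k) (\<nu> k (x k))) (\<omega> (Suc k)) > 0" if "k \<in> {t..<t + n'}" for k
    using sample_path_step(2)[OF assms(1), of k] that assms(2) by (auto simp: pmf_positive)
  then have "0 < (\<Prod>k \<in> {t..<t + n'}. pmf (outcome_law M (x k) (\<nu> k (x k))) (\<omega> (Suc k)))"
    by (intro prod_pos) auto
  with assms show ?thesis
    by (auto simp: sample_path_def realized_states_def)
qed

lemma penalty_increment_mono:
  fixes q :: "nat \<Rightarrow> real"
  assumes "\<And>n. n \<ge> 1 \<Longrightarrow> q n - q (n - 1) \<le> q (n + 1) - q n" and "m \<le> n"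
  shows "q (Suc m) - q m \<le> q (Suc n) - q n"
proof -
  have "q (Suc n) - q n \<le> q (Suc (Suc n)) - q (Suc n)" for n
    using assms(1)[of "Suc n"] by simp
  then show ?thesis
    by (rule lift_Suc_mono_le[of "\<lambda>n. q (Suc n) - q n"]) (rule assms(2))
qed

section \<open>Exchange setting: deadlines, laxity, swap stages\<close>

locale interchange =
  fixes M :: "('n::finite, 's::finite, 'd::finite) phev"
    and \<nu> :: "('n, 's, 'd) policy"
    and t :: nat
    and xt :: "('n, 's, 'd) sys_state"
    and i j :: 'n
  assumes model: "phev_model M"
    and xt_state: "xt \<in> sys_states M"
    and feasible: "feasible_policy M \<nu>"
    and prec: "prec M xt i j"
    and charged_i: "\<nu> t xt i = 1"
    and uncharged_j: "\<nu> t xt j = 0"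
begin

abbreviation \<beta> :: "'n \<Rightarrow> nat" where
  "\<beta> l \<equiv> deadline t xt l"

abbreviation span :: nat where
  "span \<equiv> interchange_span xt i j"

abbreviation hat_state :: "nat \<Rightarrow> ('n, 's, 'd) sys_state \<Rightarrow> ('n, 's, 'd) sys_state" where
  "hat_state \<equiv> hat t xt i j"

abbreviation swaps :: "(nat \<Rightarrow> ('n, 's, 'd) sys_state) \<Rightarrow> nat set" where
  "swaps \<equiv> swap_stages \<nu> t xt i j"

text \<open>Work left after the action; at \<open>k = \<beta> l - 1\<close> this is the argument of
  the penalty.\<close>

definition resid :: "(nat \<Rightarrow> ('n, 's, 'd) sys_state) \<Rightarrow> nat \<Rightarrow> 'n \<Rightarrow> nat" where
  "resid x k l = rem_proc (x k) l - \<nu> k (x k) l"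

lemma i_neq_j: "i \<noteq> j"
  using charged_i uncharged_j by auto

lemma deadlines_gt: "t < \<beta> i" "t < \<beta> j"
  using prec by (auto simp: prec_def connected_chargers_def deadline_def)

lemma deadlines_span: "\<beta> i \<le> Suc (t + span)" "\<beta> j \<le> Suc (t + span)"
  by (auto simp: interchange_span_def deadline_def)

lemma proc_i_pos: "0 < rem_proc xt i"
proof -
  have "\<nu> t xt i \<le> rem_proc xt i"
    using feasible xt_state by (auto simp: feasible_policy_def feasible_action_def)
  with charged_i show ?thesis
    by simp
qed

lemma proc_i_le_j: "rem_proc xt i \<le> rem_proc xt j"
  using prec by (simp add: prec_def)

text \<open>The laxity inequality with subtractions cleared. Since \<open>i\<close> is charged, both
  vehicles still need work and the default laxity \<open>max_stay M\<close> does not occur.\<close>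

lemma deadline_diff_le: "\<beta> j + rem_proc xt i \<le> \<beta> i + rem_proc xt j"
  using prec proc_i_pos proc_i_le_j by (auto simp: prec_def laxity_def deadline_def)

lemma swapsD:
  assumes "k \<in> swaps x"
  shows "t < k" "k < \<beta> i" "k < \<beta> j" "k \<le> t + span" "\<nu> k (x k) i = 0" "\<nu> k (x k) j = 1"
  using assms deadlines_span by (auto simp: swap_stages_def)

lemma finite_swaps: "finite (swaps x)"
  by (simp add: swap_stages_def)

section \<open>Residual work of \<open>i\<close> and \<open>j\<close> along a sample path\<close>

lemma sample_path_in_sys_states:
  assumes "sample_path M \<nu> t xt n \<omega> x" and "t \<le> k" "k \<le> t + n"
  shows "x k \<in> sys_states M"
  using assms(2,3)
proof (induction k rule: dec_induct)
  case base
  then show ?case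
    using sample_path_start[OF assms(1)] xt_state by simp
next
  case (step m)
  then show ?case
    using sample_path_step[OF assms(1), of m] next_state_in_sys_states[OF model] by simp
qed

lemma sample_path_feasible:
  assumes "sample_path M \<nu> t xt n \<omega> x" and "t \<le> k" "k \<le> t + n"
  shows "\<nu> k (x k) l \<in> {0, 1}" and "\<nu> k (x k) l \<le> rem_proc (x k) l"
  using sample_path_in_sys_states[OF assms] feasible
  unfolding feasible_policy_def feasible_action_def by blast+

text \<open>From stage \<open>\<beta> l\<close> on, charger \<open>l\<close> may hold another
  vehicle, hence the bound on \<open>k\<close>.\<close>

lemma sample_path_rem_stages:
  assumes "sample_path M \<nu> t xt n \<omega> x" and "t \<le> k" "k \<le> t + n" and "k < \<beta> l"
  shows "rem_stages (x k) l = \<beta> l - k"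
  using assms(2-)
proof (induction k rule: dec_induct)
  case base
  then show ?case
    using sample_path_start[OF assms(1)] by (simp add: deadline_def)
next
  case (step m)
  then show ?case
    using sample_path_step(1)[OF assms(1), of m] by (simp add: rem_stages_next_state)
qed

lemma sample_path_rem_proc_Suc:
  assumes "sample_path M \<nu> t xt n \<omega> x" and "t \<le> k" "k < t + n" and "Suc k < \<beta> l"
  shows "rem_proc (x (Suc k)) l = resid x k l"
  using assms sample_path_step(1)[OF assms(1), of k] sample_path_rem_stages[OF assms(1), of k l]
  by (simp add: rem_proc_next_state resid_def)

text \<open>Feasibility makes the truncated subtraction in \<open>resid\<close> exact, so the
  recursion takes an additive form suited to linear arithmetic.\<close>

lemma resid_Suc:
  assumes "sample_path M \<nu> t xt n \<omega> x" and "t \<le> k" "k < t + n" and "Suc k < \<beta> l"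
  shows "resid x (Suc k) l + \<nu> (Suc k) (x (Suc k)) l = resid x k l"
  using sample_path_rem_proc_Suc[OF assms] sample_path_feasible(2)[OF assms(1), of "Suc k" l] assms
  by (simp add: resid_def)

lemma resid_antimono:
  assumes "sample_path M \<nu> t xt n \<omega> x" and "t \<le> k" "k \<le> k'" "k' \<le> t + n" and "k' < \<beta> l"
  shows "resid x k' l \<le> resid x k l"
  using assms(3-)
proof (induction k' rule: dec_induct)
  case (step m)
  then show ?case
    using resid_Suc[OF assms(1), of m l] assms(2) by simp
qed simp

text \<open>Before the first swap stage, every charge of \<open>j\<close> is accompanied by a charge of \<open>i\<close>, and the
  charge of \<open>i\<close> at stage \<open>t\<close> has put \<open>j\<close> one further unit behind.\<close>

lemma resid_gap:
  assumes "sample_path M \<nu> t xt n \<omega> x"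
    and "t \<le> k" "k \<le> t + n" "k < \<beta> i" "k < \<beta> j" "\<forall>m \<in> swaps x. k < m"
  shows "resid x k i + rem_proc xt j + 1 \<le> resid x k j + rem_proc xt i"
  using assms(2-)
proof (induction k rule: dec_induct)
  case base
  then show ?case
    using sample_path_start[OF assms(1)] charged_i uncharged_j proc_i_pos by (simp add: resid_def)
next
  case (step m)
  have "Suc m \<notin> swaps x"
    using step.prems by auto
  then have no_swap: "\<not> (\<nu> (Suc m) (x (Suc m)) j = 1 \<and> \<nu> (Suc m) (x (Suc m)) i = 0)"
    using step.hyps step.prems by (simp add: swap_stages_def)
  have m: "t \<le> Suc m" "Suc m \<le> t + n" "m < t + n"
    using step.hyps step.prems by simp_all
  have "\<nu> (Suc m) (x (Suc m)) j \<le> \<nu> (Suc m) (x (Suc m)) i"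
    using no_swap sample_path_feasible(1)[OF assms(1) m(1,2), of i]
      sample_path_feasible(1)[OF assms(1) m(1,2), of j] by auto
  moreover have "\<forall>m' \<in> swaps x. m < m'"
    using step.prems(4) by (simp add: Suc_lessD)
  then have "resid x m i + rem_proc xt j + 1 \<le> resid x m j + rem_proc xt i"
    using step.IH step.prems(1-3) by simp
  ultimately show ?case
    using resid_Suc[OF assms(1) step.hyps(1) m(3) step.prems(2)]
      resid_Suc[OF assms(1) step.hyps(1) m(3) step.prems(3)] by linarith
qed

text \<open>Once \<open>i\<close> has left, \<open>j\<close> can catch up by at most one unit per remaining stage, which is not
  enough because \<open>j\<close> had the smaller laxity.\<close>

lemma resid_gap_after_i:
  assumes "sample_path M \<nu> t xt n \<omega> x" and "swaps x = {}"
    and "\<beta> i - 1 \<le> k" "k \<le> t + n" "k < \<beta> j"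
  shows "resid x (\<beta> i - 1) i + (\<beta> j - k) \<le> resid x k j"
  using assms(3-)
proof (induction k rule: dec_induct)
  case base
  then have "resid x (\<beta> i - 1) i + rem_proc xt j + 1 \<le> resid x (\<beta> i - 1) j + rem_proc xt i"
    using resid_gap[OF assms(1), of "\<beta> i - 1"] assms(2) deadlines_gt by simp
  \<comment> \<open>At \<open>k = \<beta> i - 1\<close> the gap is at least
    \<open>rem_proc xt j - rem_proc xt i + 1\<close>, which laxity bounds below by
    \<open>\<beta> j - \<beta> i + 1 = \<beta> j - k\<close>.\<close>
  then show ?case
    using deadline_diff_le deadlines_gt base by linarith
next
  case (step m)
  have m: "t \<le> m" "m < t + n" "t \<le> Suc m" "Suc m \<le> t + n"
    using step.hyps step.prems deadlines_gt by linarith+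
  have "\<nu> (Suc m) (x (Suc m)) j \<le> 1"
    using sample_path_feasible(1)[OF assms(1) m(3,4), of j] by auto
  moreover have "resid x (\<beta> i - 1) i + (\<beta> j - m) \<le> resid x m j"
    using step.IH step.prems by simp
  ultimately show ?case
    using resid_Suc[OF assms(1) m(1,2) step.prems(2)] step.prems by linarith
qed

text \<open>The residual of \<open>j\<close> exceeds that of \<open>i\<close>: while
  \<open>i\<close> is present because \<open>rem_proc xt i \<le> rem_proc xt j\<close>, afterwards
  because \<open>k < \<beta> j\<close>.\<close>

lemma resid_j_pos:
  assumes "sample_path M \<nu> t xt n \<omega> x"
    and "t \<le> k" "k \<le> t + n" "k < \<beta> j" "\<forall>m \<in> swaps x. k < m"
  shows "0 < resid x k j"
proof (cases "k < \<beta> i")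
  case True
  then show ?thesis
    using resid_gap[OF assms(1)] assms(2-) proc_i_le_j by force
next
  case False
  \<comment> \<open>Swap stages lie before \<open>\<beta> i \<le> k\<close>, but by assumption after
    \<open>k\<close>.\<close>
  then have "swaps x = {}"
    using assms(5) swapsD(2) by fastforce
  then show ?thesis
    using resid_gap_after_i[OF assms(1), of k] False assms by fastforce
qed

text \<open>The state at \<open>k\<close> is what stage \<open>k - 1\<close> leaves over, so
  positivity extends to the first swap stage itself. It supplies the premises of
  \<open>hat_inject\<close>.\<close>

lemma rem_proc_j_pos:
  assumes "sample_path M \<nu> t xt n \<omega> x"
    and "t < k" "k \<le> t + n" "k < \<beta> j" "\<forall>m \<in> swaps x. k \<le> m"
  shows "0 < rem_proc (x k) j"
  using resid_j_pos[OF assms(1), of "k - 1"] sample_path_rem_proc_Suc[OF assms(1), of "k - 1" j] assms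
  by force

text \<open>If \<open>i\<close> leaves no later than \<open>j\<close>, the bound after its departure
  still leaves one unit at \<open>k = \<beta> j - 1\<close>. If \<open>j\<close> leaves first, the
  gap at its last stage persists because the residual of \<open>i\<close> never grows.\<close>

lemma final_resid_less:
  assumes "sample_path M \<nu> t xt n \<omega> x" and "swaps x = {}" and "span \<le> n"
  shows "resid x (\<beta> i - 1) i < resid x (\<beta> j - 1) j"
proof (cases "\<beta> i \<le> \<beta> j")
  case True
  then show ?thesis
    using resid_gap_after_i[OF assms(1,2), of "\<beta> j - 1"] assms(3) deadlines_gt deadlines_span
    by linarith
next
  case False
  then have "resid x (\<beta> j - 1) i < resid x (\<beta> j - 1) j"
    using resid_gap[OF assms(1), of "\<beta> j - 1"] assms(2,3) deadlines_gt deadlines_span proc_i_le_j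
    by fastforce
  moreover have "resid x (\<beta> i - 1) i \<le> resid x (\<beta> j - 1) i"
    using resid_antimono[OF assms(1), of "\<beta> j - 1" "\<beta> i - 1" i] False assms(3) deadlines_gt
      deadlines_span by simp
  ultimately show ?thesis
    by simp
qed

section \<open>The state map \<open>hat\<close> and the dynamics\<close>

lemma rem_stages_hat [simp]: "rem_stages (hat_state k x) l = rem_stages x l"
  by (auto simp: hat_def rem_stages_def)

lemma grid_hat [simp]: "grid (hat_state k x) = grid x"
  and demand_hat [simp]: "demand (hat_state k x) = demand x"
  by (auto simp: hat_def)

lemma rem_proc_hat:
  "rem_proc (hat_state k x) l =
     (if l = i \<and> k < \<beta> i then rem_proc x i + 1
      else if l = j \<and> k < \<beta> j then rem_proc x j - 1 else rem_proc x l)"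
  by (auto simp: hat_def rem_proc_def)

lemma sys_state_eqI:
  assumes "\<And>l. rem_stages x l = rem_stages y l" "\<And>l. rem_proc x l = rem_proc y l"
    "grid x = grid y" "demand x = demand y"
  shows "x = (y :: ('n, 's, 'd) sys_state)"
  using assms by (intro sys_state.equality) (auto simp: rem_stages_def rem_proc_def prod_eq_iff)

lemma hat_id: "\<lbrakk> \<beta> i \<le> k; \<beta> j \<le> k \<rbrakk> \<Longrightarrow> hat_state k x = x"
  by (auto simp: hat_def)

text \<open>The extra unit of \<open>i\<close> passes through the subtraction because
  \<open>a i \<le> rem_proc x i\<close>; for \<open>j\<close>, truncated subtractions commute. The
  condition on \<open>rem_stages\<close> makes \<open>hat\<close> release a charger exactly when its
  vehicle leaves.\<close>

lemma next_state_hat: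
  assumes "a i \<le> rem_proc x i" and "\<And>l. p < \<beta> l \<Longrightarrow> rem_stages x l = \<beta> l - p"
  shows "next_state (hat_state p x) a z = hat_state (Suc p) (next_state x a z)"
proof -
  have "vehicle (next_state (hat_state p x) a z) l = vehicle (hat_state (Suc p) (next_state x a z)) l"
    for l
    using assms(1) assms(2)[of l] i_neq_j
    by (cases z) (auto simp: hat_def next_state_def rem_stages_def rem_proc_def split: option.splits)
  then show ?thesis
    by (intro sys_state.equality ext) (auto simp: hat_def next_state_def split: prod.splits)
qed

text \<open>Positivity is needed because of the truncated subtraction in \<open>hat\<close>.\<close>

lemma hat_inject:
  assumes eq: "hat_state k x = hat_state k x'"
    and pos: "k < \<beta> j \<Longrightarrow> 0 < rem_proc x j" "k < \<beta> j \<Longrightarrow> 0 < rem_proc x' j"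
  shows "x = x'"
proof (rule sys_state_eqI)
  show "rem_stages x l = rem_stages x' l" for l
    using rem_stages_hat[of k x l] rem_stages_hat[of k x' l] eq by simp
  show "grid x = grid x'" "demand x = demand x'"
    using grid_hat demand_hat eq by metis+
  show "rem_proc x l = rem_proc x' l" for l
    using rem_proc_hat[of k x l] rem_proc_hat[of k x' l] pos i_neq_j unfolding eq
    by (auto split: if_splits)
qed

section \<open>Well-definedness of the interchanging policy\<close>

text \<open>Injectivity of \<open>hat\<close> reads the path of \<open>\<nu>\<close> off the history
  \<open>h\<close> as long as no swap stage precedes \<open>c\<close>.\<close>

lemma hat_match_unique:
  assumes "sample_path M \<nu> t xt span \<omega> x" "sample_path M \<nu> t xt span \<omega>' x'"
    and "\<forall>m \<in> {t<..c}. h m = hat_state m (x m)" "\<forall>m \<in> {t<..c}. h m = hat_state m (x' m)"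
    and "\<forall>m \<in> swaps x. c \<le> m" "\<forall>m \<in> swaps x'. c \<le> m"
    and "t \<le> m" "m \<le> c" "c \<le> t + span"
  shows "x m = x' m"
proof (cases "m = t")
  case True
  then show ?thesis
    using assms(1,2) sample_path_start by metis
next
  case False
  then have m: "t < m" "m \<in> {t<..c}"
    using assms(7,8) by auto
  show ?thesis
  proof (rule hat_inject)
    show "hat_state m (x m) = hat_state m (x' m)"
      using m assms(3,4) by metis
    show "0 < rem_proc (x m) j" if "m < \<beta> j"
      using rem_proc_j_pos[OF assms(1), of m] that m assms by force
    show "0 < rem_proc (x' m) j" if "m < \<beta> j"
      using rem_proc_j_pos[OF assms(2), of m] that m assms by force
  qed
qed

lemma swaps_cong: "x k = x' k \<Longrightarrow> k \<in> swaps x \<longleftrightarrow> k \<in> swaps x'"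
  by (auto simp: swap_stages_def)

definition first_swap :: "(nat \<Rightarrow> ('n, 's, 'd) sys_state) \<Rightarrow> nat \<Rightarrow> bool" where
  "first_swap x w \<longleftrightarrow> w \<in> swaps x \<and> (\<forall>m \<in> swaps x. w \<le> m)"

lemma first_swap_iff: "first_swap x w \<longleftrightarrow> swaps x \<noteq> {} \<and> w = Min (swaps x)"
proof
  assume "first_swap x w"
  then show "swaps x \<noteq> {} \<and> w = Min (swaps x)"
    using finite_swaps[of x] by (auto simp: first_swap_def intro: Min_eqI[symmetric])
next
  assume "swaps x \<noteq> {} \<and> w = Min (swaps x)"
  then show "first_swap x w"
    using finite_swaps[of x] Min_in[of "swaps x"] by (simp add: first_swap_def)
qed

lemma before_swaps_iff: "(\<forall>m \<in> swaps x. k < m) \<longleftrightarrow> swaps x = {} \<or> k < Min (swaps x)"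
  using finite_swaps[of x] by (cases "swaps x = {}") auto

text \<open>Common premise of the rules \<open>mimic\<close>, \<open>restore\<close> and
  \<open>after_restore\<close>; a swap stage at \<open>c\<close> itself is allowed so that all three
  fit.\<close>

definition matches ::
  "(nat \<Rightarrow> ('n, 's, 'd) sys_state) \<Rightarrow> (nat \<Rightarrow> ('n, 's, 'd) sys_state) \<Rightarrow> nat \<Rightarrow> bool" where
  "matches h x c \<longleftrightarrow> (\<exists>\<omega>. sample_path M \<nu> t xt span \<omega> x) \<and>
     (\<forall>m \<in> {t<..c}. h m = hat_state m (x m)) \<and> (\<forall>m \<in> swaps x. c \<le> m) \<and> t \<le> c \<and> c \<le> t + span"

lemma matches_unique:
  assumes "matches h x c" "matches h x' c'" "t \<le> m" "m \<le> c" "m \<le> c'"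
  shows "x m = x' m"
proof -
  obtain \<omega> where x: "sample_path M \<nu> t xt span \<omega> x" "\<forall>m \<in> {t<..c}. h m = hat_state m (x m)"
      "\<forall>m \<in> swaps x. c \<le> m" "c \<le> t + span"
    using assms(1) unfolding matches_def by blast
  obtain \<omega>' where x': "sample_path M \<nu> t xt span \<omega>' x'" "\<forall>m \<in> {t<..c'}. h m = hat_state m (x' m)"
      "\<forall>m \<in> swaps x'. c' \<le> m"
    using assms(2) unfolding matches_def by blast
  show ?thesis
  proof (rule hat_match_unique[OF x(1) x'(1)])
    show "\<forall>m \<in> {t<..min c c'}. h m = hat_state m (x m)"
      using x(2) by simp
    show "\<forall>m \<in> {t<..min c c'}. h m = hat_state m (x' m)"
      using x'(2) by simp
    show "\<forall>m \<in> swaps x. min c c' \<le> m" "\<forall>m \<in> swaps x'. min c c' \<le> m"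
      using x(3) x'(3) min.coboundedI1 min.coboundedI2 by blast+
  qed (use x(4) assms(3-) in auto)
qed

text \<open>Being a swap stage depends only on the state at that stage, on which matching paths
  agree. This excludes conflicts between different rules of \<open>prescribed\<close>.\<close>

lemma matches_swap_unique:
  assumes "matches h x c" "matches h x' c'" "w \<in> swaps x" "w \<le> c" "w \<le> c'"
  shows "w \<in> swaps x'"
proof -
  have "x w = x' w"
    using matches_unique[OF assms(1,2) _ assms(4,5)] swapsD(1)[OF assms(3)] by simp
  with assms(3) show ?thesis
    by (simp add: swaps_cong[of x w x'])
qed

lemma prescribed_cases:
  assumes "prescribed M \<nu> t xt i j k h a"
  obtains (exchange) "k = t" "a = (\<nu> t xt)(i := 0, j := 1)"
  | (mimic) x where "matches h x k" "t < k" "k \<le> t + span" "\<forall>m \<in> swaps x. k < m"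
      "a = \<nu> k (x k)"
  | (restore) x where "matches h x k" "t < k" "k \<le> t + span" "k \<in> swaps x"
      "a = (\<nu> k (x k))(i := 1, j := 0)"
  | (after_restore) x w where "matches h x w" "w \<in> swaps x" "t < w" "w < k" "a = \<nu> k (h k)"
  using assms
proof cases
  case exchange
  then show ?thesis
    using that(1) by simp
next
  case (mimic \<omega> x)
  then have lt: "\<forall>m \<in> swaps x. k < m"
    by (simp add: before_swaps_iff)
  then have "\<forall>m \<in> swaps x. k \<le> m"
    by (simp add: less_imp_le)
  with mimic have "matches h x k"
    unfolding matches_def by (metis less_imp_le)
  with lt mimic show ?thesis
    using that(2) by blast
next
  case (restore \<omega> x)
  then have w: "first_swap x k"
    by (simp add: first_swap_iff)
  then have k: "k \<in> swaps x" "\<forall>m \<in> swaps x. k \<le> m"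
    by (simp_all add: first_swap_def)
  have "matches h x k"
    unfolding matches_def using restore(2) restore(6) k(2) swapsD(1,4)[OF k(1)] less_imp_le by blast
  then show ?thesis
    using that(3) restore(1) k(1) swapsD(1,4)[OF k(1)] by blast
next
  case (after_restore \<omega> x w)
  then have "first_swap x w"
    by (simp add: first_swap_iff)
  then have w: "w \<in> swaps x" "\<forall>m \<in> swaps x. w \<le> m"
    by (simp_all add: first_swap_def)
  have "matches h x w"
    unfolding matches_def
    using after_restore(2) after_restore(6) w(2) swapsD(1,4)[OF w(1)] less_imp_le by blast
  then show ?thesis
    using that(4) after_restore(1,7) w(1) swapsD(1)[OF w(1)] by blast
qed

text \<open>Makes the \<open>THE\<close> in \<open>interchanging_policy\<close> meaningful. Two uses
  of one rule see the same state; two different rules after stage \<open>t\<close> would disagree on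
  where the first swap stage lies.\<close>

lemma prescribed_unique:
  assumes "prescribed M \<nu> t xt i j k h a" "prescribed M \<nu> t xt i j k h b"
  shows "a = b"
  using assms(1)
proof (cases rule: prescribed_cases)
  case 1: exchange
  from assms(2) show ?thesis
    by (cases rule: prescribed_cases) (use 1 in auto)
next
  case 1: (mimic x)
  from assms(2) show ?thesis
  proof (cases rule: prescribed_cases)
    case (mimic x')
    then show ?thesis
      using 1 matches_unique[of h x k x' k k] by simp
  next
    case (restore x')
    then show ?thesis
      using 1 matches_swap_unique[of h x' k x k k] by auto
  next
    case (after_restore x' w)
    then show ?thesis
      using 1 matches_swap_unique[of h x' w x k w] by auto
  qed (use 1 in auto)
next
  case 1: (restore x)
  from assms(2) show ?thesis
  proof (cases rule: prescribed_cases)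
    case (mimic x')
    then show ?thesis
      using 1 matches_swap_unique[of h x k x' k k] by auto
  next
    case (restore x')
    then show ?thesis
      using 1 matches_unique[of h x k x' k k] by simp
  next
    case (after_restore x' w)
    then have "w \<in> swaps x"
      using 1 matches_swap_unique[of h x' w x k w] by auto
    then show ?thesis
      using 1 after_restore by (force simp: matches_def)
  qed (use 1 in auto)
next
  case 1: (after_restore x w)
  from assms(2) show ?thesis
  proof (cases rule: prescribed_cases)
    case (mimic x')
    then show ?thesis
      using 1 matches_swap_unique[of h x w x' k w] by auto
  next
    case (restore x')
    then have "w \<in> swaps x'"
      using 1 matches_swap_unique[of h x w x' k w] by auto
    then show ?thesis
      using 1 restore by (force simp: matches_def)
  qed (use 1 in auto)
qed

abbreviation \<rho> :: "('n, 's, 'd) history_policy" where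
  "\<rho> \<equiv> interchanging_policy M \<nu> t xt i j"

lemma policy_eqI:
  assumes "prescribed M \<nu> t xt i j k h a"
  shows "\<rho> k h = a"
proof -
  have "(THE a. prescribed M \<nu> t xt i j k h a) = a"
    using assms prescribed_unique by blast
  with assms show ?thesis
    by (auto simp: interchanging_policy_def)
qed

text \<open>Past the span only \<open>after_restore\<close> or the default branch can apply, and
  both follow \<open>\<nu>\<close> at the current state.\<close>

lemma policy_after_span:
  assumes "t + span < k"
  shows "\<rho> k h = \<nu> k (h k)"
proof (cases "\<exists>a. prescribed M \<nu> t xt i j k h a")
  case True
  then obtain a where a: "prescribed M \<nu> t xt i j k h a"
    by blast
  then have "a = \<nu> k (h k)"
    by (cases rule: prescribed_cases) (use assms in auto)
  with policy_eqI[OF a] show ?thesis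
    by simp
qed (auto simp: interchanging_policy_def)

end

section \<open>Trajectories of the two policies on one sample path\<close>

locale interchange_path = interchange M \<nu> t xt i j
  for M :: "('n::finite, 's::finite, 'd::finite) phev"
    and \<nu> :: "('n, 's, 'd) policy"
    and t :: nat
    and xt :: "('n, 's, 'd) sys_state"
    and i j :: 'n +
  fixes T :: nat
    and \<omega> :: "nat \<Rightarrow> ('n, 's, 'd) outcome"
    and x y :: "nat \<Rightarrow> ('n, 's, 'd) sys_state"
  assumes horizon: "span \<le> T"
    and path: "sample_path M \<nu> t xt T \<omega> x"
    and realized: "realized_states (interchanging_policy M \<nu> t xt i j) t xt T \<omega> y"
begin

lemma path_span: "sample_path M \<nu> t xt span \<omega> x"
  using path horizon by (rule sample_path_mono)

lemma y_start: "y t = xt"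
  using realized by (simp add: realized_states_def)

lemma y_step: "\<lbrakk> t \<le> k; k < t + T \<rbrakk> \<Longrightarrow> y (Suc k) = next_state (y k) (\<rho> k y) (\<omega> (Suc k))"
  using realized by (simp add: realized_states_def)

lemma policy_start: "\<rho> t y = (\<nu> t xt)(i := 0, j := 1)"
  by (rule policy_eqI, rule prescribed.exchange, rule y_start)

lemma policy_before:
  assumes "t < k" "\<forall>m \<in> swaps x. k < m" "\<forall>m \<in> {t<..k}. y m = hat_state m (x m)"
  shows "\<rho> k y = \<nu> k (x k)"
proof (cases "k \<le> t + span")
  case True
  then show ?thesis
    using assms path_span y_start
    by (intro policy_eqI prescribed.mimic) (simp_all add: before_swaps_iff)
next
  case False
  \<comment> \<open>Both deadlines have passed, so \<open>hat_state k\<close> is the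
    identity.\<close>
  then have "y k = x k"
    using assms deadlines_span by (simp add: hat_id)
  with False show ?thesis
    by (simp add: policy_after_span)
qed

lemma policy_swap:
  assumes "first_swap x w" "\<forall>m \<in> {t<..w}. y m = hat_state m (x m)"
  shows "\<rho> w y = (\<nu> w (x w))(i := 1, j := 0)"
proof -
  have sw: "swaps x \<noteq> {}" "w = Min (swaps x)"
    using assms(1) by (simp_all add: first_swap_iff)
  show ?thesis
    by (rule policy_eqI, rule prescribed.restore[OF path_span sw y_start assms(2)])
qed

lemma policy_after:
  assumes "first_swap x w" "\<forall>m \<in> {t<..w}. y m = hat_state m (x m)" "w < k"
  shows "\<rho> k y = \<nu> k (y k)"
proof -
  have sw: "swaps x \<noteq> {}" "w = Min (swaps x)"
    using assms(1) by (simp_all add: first_swap_iff)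
  show ?thesis
    by (rule policy_eqI, rule prescribed.after_restore[OF path_span sw y_start assms(2,3)])
qed

text \<open>The policy reads its whole history, so \<open>policy_before\<close> needs the relation
  at all earlier stages; hence the strong induction.\<close>

lemma y_before:
  assumes "t < k" "k \<le> t + T" "\<forall>m \<in> swaps x. k \<le> m"
  shows "y k = hat_state k (x k)"
  using assms
proof (induction k rule: less_induct)
  case (less k)
  show ?case
  proof (cases "k = Suc t")
    case True
    then have "t < t + T"
      using less.prems by simp
    then have steps: "y k = next_state xt (\<rho> t y) (\<omega> k)" "x k = next_state xt (\<nu> t xt) (\<omega> k)"
      using y_step[of t] sample_path_step(1)[OF path, of t] sample_path_start[OF path] y_start True
      by simp_all
    \<comment> \<open>The exchange at \<open>t\<close> creates the difference; for \<open>i\<close>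
      this uses \<open>(rem_proc xt i - 1) + 1 = rem_proc xt i\<close>.\<close>
    show ?thesis
      unfolding steps policy_start
      using proc_i_pos charged_i uncharged_j i_neq_j True
      by (intro sys_state.equality ext)
        (auto simp: hat_def next_state_def deadline_def rem_stages_def rem_proc_def
          split: prod.splits option.splits)
  next
    case False
    then obtain p where p: "k = Suc p" "t < p" "p < t + T"
      using less.prems by (cases k) auto
    have IH: "y m = hat_state m (x m)" if "m \<in> {t<..p}" for m
      using less.IH[of m] less.prems that p by force
    then have act: "\<rho> p y = \<nu> p (x p)"
      using less.prems p by (intro policy_before) auto
    have steps: "y (Suc p) = next_state (hat_state p (x p)) (\<nu> p (x p)) (\<omega> (Suc p))"
      "x (Suc p) = next_state (x p) (\<nu> p (x p)) (\<omega> (Suc p))"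
      using y_step[of p] sample_path_step(1)[OF path, of p] p IH act by simp_all
    have le: "\<nu> p (x p) i \<le> rem_proc (x p) i"
      using sample_path_feasible(2)[OF path, of p] p by simp
    have conn: "p < \<beta> l \<Longrightarrow> rem_stages (x p) l = \<beta> l - p" for l
      using sample_path_rem_stages[OF path, of p l] p by simp
    show ?thesis
      unfolding p(1) steps using le conn by (rule next_state_hat)
  qed
qed

lemma y_after:
  assumes "first_swap x w" "w < k" "k \<le> t + T"
  shows "y k = x k"
proof -
  have w: "t < w" "w < \<beta> i" "w < \<beta> j" "\<nu> w (x w) i = 0" "\<nu> w (x w) j = 1"
    "\<forall>m \<in> swaps x. w \<le> m"
    using assms(1) swapsD[of w x] by (auto simp: first_swap_def)
  have before: "\<forall>m \<in> {t<..w}. y m = hat_state m (x m)"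
    using y_before w(6) assms by force
  from assms(2) have "Suc w \<le> k"
    by simp
  then show ?thesis
    using assms(3)
  proof (induction k rule: dec_induct)
    case base
    have "y (Suc w) = next_state (hat_state w (x w)) ((\<nu> w (x w))(i := 1, j := 0)) (\<omega> (Suc w))"
      using y_step[of w] policy_swap[OF assms(1) before] before w base by simp
    \<comment> \<open>The shifts cancel against the exchanged charges:
      \<open>(n + 1) - 1 = n - 0\<close> for \<open>i\<close> and \<open>(n - 1) - 0 = n - 1\<close>
      for \<open>j\<close>.\<close>
    also have "\<dots> = next_state (x w) (\<nu> w (x w)) (\<omega> (Suc w))"
      using w i_neq_j by (intro next_state_eqI) (auto simp: rem_proc_hat)
    also have "\<dots> = x (Suc w)"
      using sample_path_step(1)[OF path, of w] w base by simp
    finally show ?case .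
  next
    case (step m)
    then show ?case
      using y_step[of m] policy_after[OF assms(1) before, of m] w
        sample_path_step(1)[OF path, of m] by simp
  qed
qed

section \<open>Comparison of stage costs\<close>

lemma num_charged_swap:
  assumes "i \<in> connected_chargers z" "j \<in> connected_chargers z"
    and "a i + a j = b i + b j" and "\<And>l. l \<noteq> i \<Longrightarrow> l \<noteq> j \<Longrightarrow> a l = b l"
  shows "num_charged z a = num_charged z b"
proof -
  let ?C = "connected_chargers z"
  have split: "num_charged z f = f i + f j + sum f (?C - {i} - {j})" for f
    using assms(1,2) i_neq_j sum.remove[of ?C i f] sum.remove[of "?C - {i}" j f]
    by (simp add: num_charged_def)
  have "sum a (?C - {i} - {j}) = sum b (?C - {i} - {j})"
    using assms(4) by (intro sum.cong) auto
  then show ?thesis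
    using assms(3) by (simp add: split)
qed

lemma num_charged_cong:
  "(\<And>l. rem_stages z l = rem_stages z' l) \<Longrightarrow> num_charged z a = num_charged z' a"
  by (simp add: num_charged_def connected_chargers_def)

text \<open>In the last claim the residuals already coincide at the first swap stage, hence \<open>k < m\<close>.\<close>

lemma stage_compare:
  assumes "t \<le> k" "k \<le> t + T"
  shows "grid (y k) = grid (x k)" (is ?grid)
    and "\<And>l. rem_stages (y k) l = rem_stages (x k) l" (is "\<And>l. ?stages l")
    and "num_charged (y k) (\<rho> k y) = num_charged (x k) (\<nu> k (x k))" (is ?num)
    and "\<And>l. rem_proc (y k) l - \<rho> k y l =
           (if l = i \<and> k < \<beta> i \<and> (\<forall>m \<in> swaps x. k < m) then resid x k i + 1
            else if l = j \<and> k < \<beta> j \<and> (\<forall>m \<in> swaps x. k < m) then resid x k j - 1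
            else resid x k l)" (is "\<And>l. ?proc l")
proof -
  have "?grid \<and> (\<forall>l. ?stages l) \<and> ?num \<and> (\<forall>l. ?proc l)"
  proof -
    \<comment> \<open>The cases mirror the rules of \<open>prescribed\<close>; \<open>before\<close>
      also covers stages past the span when there is no swap stage.\<close>
    consider (start) "k = t" | (before) "t < k" "\<forall>m \<in> swaps x. k < m"
      | (swap) "first_swap x k" | (after) w where "first_swap x w" "w < k"
    proof (cases "\<forall>m \<in> swaps x. k < m")
      case False
      then have "swaps x \<noteq> {}"
        by auto
      then have "first_swap x (Min (swaps x))"
        by (simp add: first_swap_iff)
      moreover from this have "Min (swaps x) \<le> k"
        using False by (fastforce simp: first_swap_def)
      ultimately show ?thesis
        using that(3,4) by (metis le_neq_implies_less)
    qed (use assms that in force)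
    then show ?thesis
    proof cases
      case start
      have "i \<in> connected_chargers xt" "j \<in> connected_chargers xt"
        using prec by (auto simp: prec_def)
      then have "num_charged xt ((\<nu> t xt)(i := 0, j := 1)) = num_charged xt (\<nu> t xt)"
        using charged_i uncharged_j i_neq_j by (intro num_charged_swap) auto
      moreover have "\<forall>m \<in> swaps x. t < m"
        using swapsD(1) by blast
      ultimately show ?thesis
        using start y_start sample_path_start[OF path] policy_start charged_i uncharged_j i_neq_j
          deadlines_gt proc_i_pos
        by (auto simp: resid_def)
    next
      case before
      have hat: "\<forall>m \<in> {t<..k}. y m = hat_state m (x m)"
        using y_before before(2) assms(2) by force
      then have y: "y k = hat_state k (x k)"
        using before(1) by simp
      have "num_charged (hat_state k (x k)) (\<nu> k (x k)) = num_charged (x k) (\<nu> k (x k))"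
        by (intro num_charged_cong) simp
      moreover have "\<nu> k (x k) i \<le> rem_proc (x k) i"
        using sample_path_feasible(2)[OF path] assms by blast
      ultimately show ?thesis
        using before i_neq_j by (auto simp: y policy_before[OF before hat] rem_proc_hat resid_def)
    next
      case swap
      then have k: "t < k" "k < \<beta> i" "k < \<beta> j" "\<nu> k (x k) i = 0" "\<nu> k (x k) j = 1"
        "k \<in> swaps x" "\<forall>m \<in> swaps x. k \<le> m"
        using swapsD[of k x] by (auto simp: first_swap_def)
      have hat: "\<forall>m \<in> {t<..k}. y m = hat_state m (x m)"
        using y_before k(7) assms(2) by force
      then have y: "y k = hat_state k (x k)"
        using k(1) by simp
      have "num_charged (hat_state k (x k)) ((\<nu> k (x k))(i := 1, j := 0)) =
          num_charged (x k) ((\<nu> k (x k))(i := 1, j := 0))"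
        by (intro num_charged_cong) simp
      also have "\<dots> = num_charged (x k) (\<nu> k (x k))"
        using k i_neq_j sample_path_rem_stages[OF path assms]
        by (intro num_charged_swap) (auto simp: connected_chargers_def)
      finally show ?thesis
        using k i_neq_j by (auto simp: y policy_swap[OF swap hat] rem_proc_hat resid_def)
    next
      case after
      then have w: "w \<in> swaps x" "\<forall>m \<in> swaps x. w \<le> m"
        by (simp_all add: first_swap_def)
      have "\<forall>m \<in> {t<..w}. y m = hat_state m (x m)"
        using y_before w(2) after(2) assms(2) by force
      then have "\<rho> k y = \<nu> k (y k)"
        using policy_after after by blast
      moreover have "\<not> (\<forall>m \<in> swaps x. k < m)"
        using w(1) after(2) less_asym by blast
      ultimately show ?thesis
        using y_after[OF after assms(2)] by (auto simp: resid_def)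
    qed
  qed
  then show ?grid "\<And>l. ?stages l" ?num "\<And>l. ?proc l"
    by blast+
qed

text \<open>Penalties are due only at a vehicle's last stage, and the first swap stage lies before
  both deadlines, so by then the residuals agree again.\<close>

lemma stage_cost_eq_if_swap:
  assumes "t \<le> k" "k \<le> t + T" "swaps x \<noteq> {}"
  shows "stage_cost M (y k) (\<rho> k y) = stage_cost M (x k) (\<nu> k (x k))"
proof -
  note cmp = stage_compare[OF assms(1,2)]
  have "rem_proc (y k) l - \<rho> k y l = rem_proc (x k) l - \<nu> k (x k) l"
    if "rem_stages (x k) l = 1" for l
  proof -
    have "\<not> (\<forall>m \<in> swaps x. k < m)" if "l \<in> {i, j}" "k < \<beta> l"
    proof -
      \<comment> \<open>At the last stage of \<open>l\<close>, every swap stage is at most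
        \<open>k\<close>; equality is harmless since the residuals agree from the swap stage
        on.\<close>
      have "Suc k = \<beta> l"
        using sample_path_rem_stages[OF path assms(1,2), of l] that \<open>rem_stages (x k) l = 1\<close> by simp
      then show ?thesis
        using assms(3) swapsD(2,3)[of _ x] that by fastforce
    qed
    then show ?thesis
      using cmp(4)[of l] by (auto simp: resid_def)
  qed
  then show ?thesis
    using cmp(1-3) by (auto simp: stage_cost_def connected_chargers_def intro!: sum.cong)
qed

text \<open>The residuals of \<open>i\<close> and \<open>j\<close> stay shifted by one until their
  deadlines, but the shift is paid for only at each vehicle's last stage.\<close>

lemma stage_cost_no_swap:
  assumes "t \<le> k" "k \<le> t + T" "swaps x = {}"
  shows "stage_cost M (y k) (\<rho> k y) = stage_cost M (x k) (\<nu> k (x k))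
    + (if k = \<beta> i - 1 then penalty M (resid x k i + 1) - penalty M (resid x k i) else 0)
    + (if k = \<beta> j - 1 then penalty M (resid x k j - 1) - penalty M (resid x k j) else 0)"
proof -
  note cmp = stage_compare[OF assms(1,2)]
  let ?D = "{l \<in> connected_chargers (x k). rem_stages (x k) l = 1}"
  let ?di = "penalty M (resid x k i + 1) - penalty M (resid x k i)"
  let ?dj = "penalty M (resid x k j - 1) - penalty M (resid x k j)"
  \<comment> \<open>\<open>k < \<beta> l\<close> singles out the vehicle present at stage
    \<open>t\<close>; a later one at charger \<open>l\<close> may also have one stage left.\<close>
  have D: "l \<in> ?D \<and> k < \<beta> l \<longleftrightarrow> k = \<beta> l - 1" if "t < \<beta> l" for l
    using sample_path_rem_stages[OF path assms(1,2), of l] that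
    by (auto simp: connected_chargers_def)
  have "(\<Sum>l \<in> ?D. penalty M (rem_proc (y k) l - \<rho> k y l)) =
      (\<Sum>l \<in> ?D. penalty M (rem_proc (x k) l - \<nu> k (x k) l)
        + (if l = i then if k < \<beta> i then ?di else 0 else 0)
        + (if l = j then if k < \<beta> j then ?dj else 0 else 0))"
    using cmp(4) assms(3) i_neq_j by (intro sum.cong) (auto simp: resid_def)
  also have "\<dots> = (\<Sum>l \<in> ?D. penalty M (rem_proc (x k) l - \<nu> k (x k) l))
      + (if i \<in> ?D \<and> k < \<beta> i then ?di else 0) + (if j \<in> ?D \<and> k < \<beta> j then ?dj else 0)"
    by (simp add: sum.distrib sum.delta)
  finally show ?thesis
    using cmp(1-3) unfolding D[OF deadlines_gt(1)] D[OF deadlines_gt(2)]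
    by (simp add: stage_cost_def connected_chargers_def)
qed

section \<open>Summation over the horizon\<close>

lemma total_cost_le:
  assumes "\<And>n. n \<ge> 1 \<Longrightarrow> penalty M n - penalty M (n - 1) \<le> penalty M (n + 1) - penalty M n"
  shows "(\<Sum>k = t..t + T. stage_cost M (y k) (\<rho> k y))
         \<le> (\<Sum>k = t..t + T. stage_cost M (x k) (\<nu> k (x k)))"
proof (cases "swaps x = {}")
  case False
  then show ?thesis
    by (intro sum_mono) (simp add: stage_cost_eq_if_swap)
next
  case True
  let ?ri = "resid x (\<beta> i - 1) i" and ?rj = "resid x (\<beta> j - 1) j"
  \<comment> \<open>By \<open>span \<le> T\<close> the sum contains the last stages of both
    vehicles, so both penalty changes are collected.\<close>
  have deadlines: "\<beta> i - 1 \<in> {t..t + T}" "\<beta> j - 1 \<in> {t..t + T}"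
    using deadlines_gt deadlines_span horizon by auto
  have less: "?ri < ?rj"
    using final_resid_less[OF path True horizon] .
  have "(\<Sum>k = t..t + T. stage_cost M (y k) (\<rho> k y)) =
      (\<Sum>k = t..t + T. stage_cost M (x k) (\<nu> k (x k))
        + (if k = \<beta> i - 1 then penalty M (?ri + 1) - penalty M ?ri else 0)
        + (if k = \<beta> j - 1 then penalty M (?rj - 1) - penalty M ?rj else 0))"
    using True by (intro sum.cong) (auto simp: stage_cost_no_swap)
  also have "\<dots> = (\<Sum>k = t..t + T. stage_cost M (x k) (\<nu> k (x k)))
      + (penalty M (?ri + 1) - penalty M ?ri) + (penalty M (?rj - 1) - penalty M ?rj)"
    using deadlines by (simp add: sum.distrib sum.delta)
  also have "\<dots> \<le> (\<Sum>k = t..t + T. stage_cost M (x k) (\<nu> k (x k)))"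
  proof -
    have "?ri \<le> ?rj - 1"
      using less by simp
    \<comment> \<open>The extra unit of \<open>i\<close> costs the increment at \<open>?ri\<close>,
      the unit saved on \<open>j\<close> is worth the increment at \<open>?rj - 1\<close>;
      \<open>?rj > 0\<close> turns \<open>Suc (?rj - 1)\<close> into \<open>?rj\<close>.\<close>
    with assms have "penalty M (Suc ?ri) - penalty M ?ri
        \<le> penalty M (Suc (?rj - 1)) - penalty M (?rj - 1)"
      by (rule penalty_increment_mono)
    with less show ?thesis
      by simp
  qed
  finally show ?thesis .
qed

end

theorem mainTheorem1:
  fixes M :: "('n::finite, 's::finite, 'd::finite) phev"
    and \<nu> :: "('n, 's, 'd) policy"
    and xt :: "('n, 's, 'd) sys_state"
    and i j :: 'n
    and t T :: nat
    and \<omega> :: "nat \<Rightarrow> ('n, 's, 'd) outcome"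
    and x y :: "nat \<Rightarrow> ('n, 's, 'd) sys_state"
  assumes "phev_model M"
    and "\<And>n. n \<ge> 1 \<Longrightarrow>
           0 \<le> penalty M n - penalty M (n - 1) \<and>
           penalty M n - penalty M (n - 1) \<le> penalty M (n + 1) - penalty M n"
    and "xt \<in> sys_states M"
    and "feasible_policy M \<nu>"
    and "prec M xt i j"
    and "\<nu> t xt i = 1" and "\<nu> t xt j = 0"
    and "T \<ge> max (rem_stages xt j) (rem_stages xt i) - 1"
    and "sample_path M \<nu> t xt T \<omega> x"
    and "realized_states (interchanging_policy M \<nu> t xt i j) t xt T \<omega> y"
  shows "(\<Sum>k = t..t + T. stage_cost M (y k) (interchanging_policy M \<nu> t xt i j k y))
         \<le> (\<Sum>k = t..t + T. stage_cost M (x k) (\<nu> k (x k)))"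
proof -
  interpret interchange_path M \<nu> t xt i j T \<omega> x y
    using assms by unfold_locales (auto simp: interchange_span_def max.commute)
  show ?thesis
    using assms(2) by (intro total_cost_le) blast
qed

end
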